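(* Let $p$ be a prime and let $\sqrt{p}=\langle n;\overline{\alpha,\beta,\ldots}\rangle$ be the regular continued fraction of $\sqrt{p}$, where $n=\lfloor\sqrt{p}\rfloor$. Let $h_2=1+\alpha\beta$ be the denominator of the second convergent. Then $h_2\le 2n$.
   Context: For a prime $p$, the regular continued fraction of $\sqrt{p}$ has the form $\sqrt{p}=\langle n,\overline{a_1,a_2,\ldots,a_{l-1},2n}\rangle$, where $n=\lfloor\sqrt{p}\rfloor$, the bar denotes the repeating block, $l$ is the length of the period, and $a_i=a_{l-i}$. The $i$-th convergent is $\frac{k_i}{h_i}=n+\frac{1}{a_1+\frac{1}{a_2+\cdots+\frac{1}{a_i}}}$, with denominators $h_0=1$, $h_1=a_1$, $h_2=1+a_1a_2$. In the claim, $\alpha=a_1$ and $\beta=a_2$.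
   Formalization: The period length l of the continued fraction of √p is assumed to be at least 3; for l = 1 or l = 2 the inequality always fails (for example p = 2 gives h_2 = 5 > 2 and p = 3 gives h_2 = 3 > 2). *)

theory Defs
  imports Complex_Main "HOL-Computational_Algebra.Primes"
begin

text \<open>
  Regular continued fraction of a real number. Only irrational arguments are meaningful:
  for rational \<open>x\<close> the expansion should stop, whereas here division by zero continues it
  with junk values.
\<close>

primrec cf_complete_quotient :: "real \<Rightarrow> nat \<Rightarrow> real" where
  "cf_complete_quotient x 0 = x"
| "cf_complete_quotient x (Suc i) = 1 / frac (cf_complete_quotient x i)"

definition cf_coeff :: "real \<Rightarrow> nat \<Rightarrow> int" where
  "cf_coeff x i = \<lfloor>cf_complete_quotient x i\<rfloor>"

fun cf_value :: "int list \<Rightarrow> rat" where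
  "cf_value [] = 0"
| "cf_value [a] = of_int a"
| "cf_value (a # b # as) = of_int a + 1 / cf_value (b # as)"

definition cf_convergent :: "real \<Rightarrow> nat \<Rightarrow> rat" where
  "cf_convergent x i = cf_value (map (cf_coeff x) [0..<Suc i])"

text \<open>\<open>quotient_of\<close> yields the reduced fraction with positive denominator.\<close>

definition cf_denominator :: "real \<Rightarrow> nat \<Rightarrow> int" where
  "cf_denominator x i = snd (quotient_of (cf_convergent x i))"

text \<open>
  The expansion is \<open>\<langle>a\<^sub>0; a\<^sub>1, \<dots>, a\<^sub>l, a\<^sub>1, \<dots>, a\<^sub>l, \<dots>\<rangle>\<close>: the repeating block starts directly
  after \<open>a\<^sub>0\<close>, as it does for square roots of non-square integers.
\<close>

definition cf_repeats :: "real \<Rightarrow> nat \<Rightarrow> bool" where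
  "cf_repeats x l \<longleftrightarrow> l > 0 \<and> (\<forall>i\<ge>1. cf_coeff x (i + l) = cf_coeff x i)"

definition cf_period_length :: "real \<Rightarrow> nat \<Rightarrow> bool" where
  "cf_period_length x l \<longleftrightarrow> cf_repeats x l \<and> (\<forall>m. cf_repeats x m \<longrightarrow> l \<le> m)"

end

theory Submission
  imports Defs
begin

text \<open>
  A prime \<open>p\<close> is not a perfect square, so \<open>p = n\<^sup>2 + r\<close> with \<open>1 \<le> r \<le> 2n\<close>.
  Divide: \<open>2n = \<alpha>r + t\<close> with \<open>0 \<le> t < r\<close>. The first complete quotient is
  \<open>(\<surd>p + n)/r\<close>, whose integer part is the quotient \<open>\<alpha>\<close> of this division, and the
  second one works out to \<open>(\<surd>p + n - t)/(1 + t\<alpha>)\<close>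
  (lemmas \<open>cf_complete_quotient_sqrt_1\<close>, \<open>cf_coeff_sqrt_1\<close>, \<open>cf_complete_quotient_sqrt_2\<close>).

  If \<open>t = 0\<close>, the second complete quotient is \<open>\<surd>p + n\<close>, which has the same fractional part
  as \<open>\<surd>p\<close>; the expansion then repeats with period dividing 2
  (lemma \<open>cf_repeats_two_sqrt\<close>). A period of length at least 3 therefore forces \<open>t \<ge> 1\<close>.

  If \<open>t \<ge> 1\<close>, taking the integer part gives \<open>\<beta>(1 + t\<alpha>) \<le> 2n - t = \<alpha>r\<close>. Hence
  \<open>\<beta>(1 + \<alpha>) \<le> \<alpha>r\<close>, and as \<open>\<beta> \<ge> 1\<close> this gives
  \<open>1 + \<alpha>\<beta> \<le> \<alpha>r < 2n\<close>.
\<close>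

section \<open>The second convergent\<close>

lemma cf_coeff_Suc_ge_1:
  assumes "cf_complete_quotient x (Suc i) > 0"
  shows "cf_coeff x (Suc i) \<ge> 1"
proof -
  let ?f = "frac (cf_complete_quotient x i)"
  have "?f > 0" "?f < 1"
    using assms frac_lt_1 by auto
  then have "1 \<le> 1 / ?f"
    by simp
  then show ?thesis
    by (simp add: cf_coeff_def le_floor_iff)
qed

lemma quotient_of_divide_coprime:
  assumes "b > 0" "coprime a b"
  shows "quotient_of (of_int a / of_int b) = (a, b)"
  using assms by (simp add: Fract_of_int_quotient [symmetric] quotient_of_Fract normalize_stable)

text \<open>
  The convergent is \<open>a + c/(1 + bc)\<close>, and a common divisor of \<open>c\<close> and \<open>1 + bc\<close> divides 1.
  With \<open>c = 0\<close> the inner quotient \<open>1/c\<close> would take the value 0, and the denominator would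
  be \<open>b\<close>.
\<close>

lemma cf_denominator_2:
  assumes "cf_coeff x 1 \<ge> 1" "cf_coeff x 2 \<ge> 1"
  shows "cf_denominator x 2 = 1 + cf_coeff x 1 * cf_coeff x 2"
proof -
  define a b c where "a = cf_coeff x 0" and "b = cf_coeff x 1" and "c = cf_coeff x 2"
  have pos: "b \<ge> 1" "c \<ge> 1"
    using assms by (simp_all add: b_def c_def)
  then have bc: "1 + b * c > 0"
    by (simp add: add_pos_nonneg)
  have "[0..<Suc 2] = [0, 1, 2]"
    by (simp add: upt_rec)
  then have "cf_convergent x 2 = of_int a + 1 / (of_int b + 1 / of_int c)"
    by (simp add: cf_convergent_def a_def b_def c_def)
  also have "\<dots> = of_int (a * (1 + b * c) + c) / of_int (1 + b * c)"
  proof -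
    have "of_int c \<noteq> (0::rat)" "of_int (1 + b * c) \<noteq> (0::rat)"
      using pos bc by (simp, linarith)
    then show ?thesis
      by (simp add: field_simps)
  qed
  finally have conv: "cf_convergent x 2 = of_int (a * (1 + b * c) + c) / of_int (1 + b * c)" .
  have "coprime (a * (1 + b * c) + c) (1 + b * c)"
  proof (rule coprimeI)
    fix d assume d: "d dvd a * (1 + b * c) + c" "d dvd 1 + b * c"
    then have "d dvd c"
      by (simp add: dvd_add_right_iff)
    with d(2) show "is_unit d"
      using dvd_add_left_iff dvd_mult by blast
  qed
  with bc show ?thesis
    by (simp only: cf_denominator_def conv quotient_of_divide_coprime snd_conv b_def c_def)
qed

section \<open>Complete quotients of square roots\<close>

text \<open>
  One step of the classical recursion for quadratic surds: subtracting the integer part \<open>a\<close>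
  turns \<open>(\<surd>N + m)/q\<close> into \<open>(\<surd>N - m')/q\<close> with \<open>m' = aq - m\<close>, and its reciprocal is
  rationalised by multiplying with the conjugate \<open>\<surd>N + m'\<close>.
\<close>

lemma cf_complete_quotient_sqrt_step:
  assumes quot: "cf_complete_quotient (sqrt (real N)) i = (sqrt (real N) + of_int m) / of_int q"
    and m': "m' = cf_coeff (sqrt (real N)) i * q - m"
    and q': "int N - m'\<^sup>2 = q * q'"
    and nz: "q \<noteq> 0" "q' \<noteq> 0"
  shows "cf_complete_quotient (sqrt (real N)) (Suc i) = (sqrt (real N) + of_int m') / of_int q'"
proof -
  let ?s = "sqrt (real N)"
  have "real_of_int (int N - m'\<^sup>2) = of_int (q * q')"
    using q' by (rule arg_cong)
  then have prod: "(?s - of_int m') * (?s + of_int m') = of_int q * of_int q'"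
    by (simp add: algebra_simps power2_eq_square)
  with nz have ne: "?s - of_int m' \<noteq> 0"
    by auto
  have "frac (cf_complete_quotient ?s i) = (?s - of_int m') / of_int q"
    using nz by (simp add: frac_def quot m' cf_coeff_def field_simps)
  then have "cf_complete_quotient ?s (Suc i) = of_int q / (?s - of_int m')"
    by simp
  also have "\<dots> = (?s + of_int m') / of_int q'"
    using ne nz prod by (simp add: frac_eq_eq mult.commute)
  finally show ?thesis .
qed

context
  fixes N :: nat and n r :: int
  assumes n: "n = \<lfloor>sqrt (real N)\<rfloor>"
    and r: "r = int N - n\<^sup>2"
    and not_square: "r \<noteq> 0"
begin

lemma floor_sqrt_bounds: "0 \<le> n" "real_of_int n \<le> sqrt (real N)"
  using n by simp_all

lemma sqrt_remainder_pos: "0 < r"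
proof -
  have "(real_of_int n)\<^sup>2 \<le> (sqrt (real N))\<^sup>2"
    using floor_sqrt_bounds by (intro power_mono) auto
  then have "real_of_int (n\<^sup>2) \<le> real_of_int (int N)"
    by simp
  then show ?thesis
    using r not_square by linarith
qed

lemma sqrt_remainder_le: "r \<le> 2 * n"
proof -
  have "sqrt (real N) < real_of_int (n + 1)"
    using n by linarith
  then have "(sqrt (real N))\<^sup>2 < (real_of_int (n + 1))\<^sup>2"
    by (intro power_strict_mono) auto
  then have "real_of_int (int N) < real_of_int ((n + 1)\<^sup>2)"
    by simp
  then have "int N < (n + 1)\<^sup>2"
    by linarith
  then show ?thesis
    using r by (simp add: power2_eq_square algebra_simps)
qed

lemma floor_sqrt_add_divide:
  assumes "q \<ge> 0"
  shows "\<lfloor>(sqrt (real N) + of_int m) / of_int q\<rfloor> = (n + m) div q"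
  using assms n by (simp add: floor_divide_real_eq_div)

lemma cf_complete_quotient_sqrt_1:
  "cf_complete_quotient (sqrt (real N)) 1 = (sqrt (real N) + of_int n) / of_int r"
proof -
  have "cf_complete_quotient (sqrt (real N)) (Suc 0) = (sqrt (real N) + of_int n) / of_int r"
    by (rule cf_complete_quotient_sqrt_step [where m = 0 and q = 1])
      (use n r not_square in \<open>simp_all add: cf_coeff_def\<close>)
  then show ?thesis
    by simp
qed

lemma cf_coeff_sqrt_1: "cf_coeff (sqrt (real N)) 1 = 2 * n div r"
  unfolding cf_coeff_def cf_complete_quotient_sqrt_1
  using floor_sqrt_add_divide [of r n] sqrt_remainder_pos by simp

text \<open>
  With \<open>2n = ar + t\<close>, the recursion step sends \<open>m = n\<close> to \<open>m' = ar - n = n - t\<close>. The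
  new denominator is explicit because
  \<open>N - (n - t)\<^sup>2 = r + t(2n - t) = r + tar\<close>, a multiple of \<open>r\<close> with cofactor \<open>1 + ta\<close>.
\<close>

lemma cf_complete_quotient_sqrt_2:
  "cf_complete_quotient (sqrt (real N)) 2 =
    (sqrt (real N) + of_int (n - 2 * n mod r)) / of_int (1 + 2 * n mod r * (2 * n div r))"
proof -
  define a t where "a = 2 * n div r" and "t = 2 * n mod r"
  have div: "2 * n = a * r + t"
    by (simp add: a_def t_def)
  have "a \<ge> 0" "t \<ge> 0"
    using sqrt_remainder_pos floor_sqrt_bounds
    by (simp_all add: a_def t_def pos_imp_zdiv_nonneg_iff)
  then have pos: "1 + t * a > 0"
    by (simp add: add_pos_nonneg)
  have "int N - (n - t)\<^sup>2 = r + t * (2 * n - t)"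
    by (simp add: r power2_eq_square algebra_simps)
  also have "2 * n - t = a * r"
    using div by simp
  finally have prod: "int N - (n - t)\<^sup>2 = r * (1 + t * a)"
    by (simp add: algebra_simps)
  have "n - t = cf_coeff (sqrt (real N)) 1 * r - n"
    unfolding cf_coeff_sqrt_1 using div by (simp add: a_def)
  then have "cf_complete_quotient (sqrt (real N)) (Suc 1) =
      (sqrt (real N) + of_int (n - t)) / of_int (1 + t * a)"
    using pos by (intro cf_complete_quotient_sqrt_step
      [OF cf_complete_quotient_sqrt_1 _ prod not_square]) simp_all
  then show ?thesis
    by (simp only: a_def t_def Suc_1)
qed

text \<open>
  A complete quotient depends only on the fractional part of its predecessor, so it is
  enough that the second complete quotient differs from \<open>\<surd>N\<close> by an integer.
\<close>

lemma cf_repeats_two_sqrt: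
  assumes "r dvd 2 * n"
  shows "cf_repeats (sqrt (real N)) 2"
proof -
  let ?\<xi> = "cf_complete_quotient (sqrt (real N))"
  have "?\<xi> 2 = sqrt (real N) + of_int n"
    using assms by (simp add: cf_complete_quotient_sqrt_2)
  then have "frac (?\<xi> 2) = frac (?\<xi> 0)"
    by (simp add: frac_def)
  then have base: "?\<xi> (Suc 2) = ?\<xi> (Suc 0)"
    by (simp only: cf_complete_quotient.simps)
  have "?\<xi> (Suc j + 2) = ?\<xi> (Suc j)" for j
  proof (induction j)
    case 0
    then show ?case using base by (simp add: numeral_2_eq_2)
  next
    case (Suc j)
    then show ?case
      by (metis add_Suc cf_complete_quotient.simps(2))
  qed
  then show ?thesis
    unfolding cf_repeats_def cf_coeff_def
    by (metis Suc_le_D One_nat_def zero_less_numeral)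
qed

lemma cf_coeff_sqrt_ge_1:
  "cf_coeff (sqrt (real N)) 1 \<ge> 1" "cf_coeff (sqrt (real N)) 2 \<ge> 1"
proof -
  show one: "cf_coeff (sqrt (real N)) 1 \<ge> 1"
    unfolding cf_coeff_sqrt_1
    using sqrt_remainder_pos sqrt_remainder_le by (simp add: int_one_le_iff_zero_less pos_imp_zdiv_pos_iff)
  have "2 * n - 2 * n mod r = 2 * n div r * r"
    by (simp add: minus_mod_eq_div_mult)
  also have "\<dots> > 0"
    using one sqrt_remainder_pos unfolding cf_coeff_sqrt_1 by simp
  finally have "real_of_int (n - 2 * n mod r) > - real_of_int n"
    by linarith
  then have num: "sqrt (real N) + of_int (n - 2 * n mod r) > 0"
    using floor_sqrt_bounds by linarith
  have "2 * n mod r * (2 * n div r) \<ge> 0"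
    using sqrt_remainder_pos one unfolding cf_coeff_sqrt_1 by simp
  then have "real_of_int (1 + 2 * n mod r * (2 * n div r)) > 0"
    by linarith
  with num have "cf_complete_quotient (sqrt (real N)) (Suc 1) > 0"
    by (simp only: Suc_1 cf_complete_quotient_sqrt_2 divide_pos_pos)
  from cf_coeff_Suc_ge_1 [OF this] show "cf_coeff (sqrt (real N)) 2 \<ge> 1"
    by (simp only: Suc_1)
qed

section \<open>Bounding the denominator\<close>

lemma cf_coeff_sqrt_product_less:
  assumes "\<not> r dvd 2 * n"
  shows "1 + cf_coeff (sqrt (real N)) 1 * cf_coeff (sqrt (real N)) 2 < 2 * n"
proof -
  define a b t where "a = cf_coeff (sqrt (real N)) 1" and "b = cf_coeff (sqrt (real N)) 2"
    and "t = 2 * n mod r"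
  have a: "a = 2 * n div r"
    by (simp only: a_def cf_coeff_sqrt_1)
  have div: "2 * n = a * r + t"
    by (simp add: a t_def)
  have ab: "a \<ge> 1" "b \<ge> 1"
    using cf_coeff_sqrt_ge_1 by (simp_all only: a_def b_def)
  have "t \<noteq> 0" "t \<ge> 0"
    using assms sqrt_remainder_pos by (simp_all add: t_def dvd_eq_mod_eq_0)
  then have t: "t \<ge> 1"
    by simp
  have pos: "1 + t * a > 0"
    using t ab by (simp add: add_pos_nonneg)
  have "b = (n + (n - t)) div (1 + t * a)"
    unfolding b_def cf_coeff_def cf_complete_quotient_sqrt_2
    unfolding t_def [symmetric] a [symmetric]
    using pos by (intro floor_sqrt_add_divide) simp
  also have "n + (n - t) = a * r"
    using div by simp
  finally have "b = a * r div (1 + t * a)" .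
  then have "b * (1 + t * a) = a * r div (1 + t * a) * (1 + t * a)"
    by (rule arg_cong)
  then have "b * (1 + t * a) \<le> a * r"
    using pos minus_mod_eq_div_mult [of "a * r" "1 + t * a"]
      pos_mod_sign [of "1 + t * a" "a * r"] by linarith
  \<comment> \<open>Nonzero remainder: replacing \<open>t\<close> by 1 leaves exactly \<open>b + ab \<le> ar\<close>.\<close>
  moreover have "b * (1 + a) \<le> b * (1 + t * a)"
    using t ab by (intro mult_left_mono add_left_mono) auto
  ultimately have "b + a * b \<le> a * r"
    by (simp add: algebra_simps)
  then show ?thesis
    using div t ab unfolding a_def [symmetric] b_def [symmetric] by linarith
qed

end

theorem proposition4p3:
  fixes p l :: nat and n \<alpha> \<beta> :: int
  assumes "prime p"
    and "n = \<lfloor>sqrt (real p)\<rfloor>"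
    and "cf_period_length (sqrt (real p)) l"
    and "l \<ge> 3"
    and "\<alpha> = cf_coeff (sqrt (real p)) 1"
    and "\<beta> = cf_coeff (sqrt (real p)) 2"
  shows "cf_denominator (sqrt (real p)) 2 = 1 + \<alpha> * \<beta>
    \<and> cf_denominator (sqrt (real p)) 2 \<le> 2 * n"
proof -
  have "int p \<noteq> n\<^sup>2"
  proof
    assume "int p = n\<^sup>2"
    then have "prime (n\<^sup>2)"
      using assms(1) by (metis prime_nat_int_transfer)
    then show False
      by (simp add: prime_power_iff)
  qed
  then have nz: "int p - n\<^sup>2 \<noteq> 0"
    by simp
  have "\<not> cf_repeats (sqrt (real p)) 2"
    using assms(3,4) by (auto simp: cf_period_length_def)
  then have "\<not> (int p - n\<^sup>2) dvd 2 * n"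
    using cf_repeats_two_sqrt [OF assms(2) refl nz] by blast
  then have "1 + \<alpha> * \<beta> < 2 * n"
    using cf_coeff_sqrt_product_less [OF assms(2) refl nz] assms(5,6) by simp
  moreover have "cf_denominator (sqrt (real p)) 2 = 1 + \<alpha> * \<beta>"
    using cf_denominator_2 cf_coeff_sqrt_ge_1 [OF assms(2) refl nz] assms(5,6) by simp
  ultimately show ?thesis
    by simp
qed

end
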